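(* Let $x^*\in\Omega$ be an S-stationary point of the MPEC at which the MPEC-MFCQ holds. For constants $M>0$ and $\rho>0$, consider the mixed-integer linear program (a reformulation of the reduced LPEC) in the variables $d=(d_0,d_1,d_2)\in\mathbb R^n$, $y\in\{0,1\}^{|\mathcal I_{00}(x^* )|}$ (components $y_i$ indexed by $i\in\mathcal I_{00}(x^* )$): $$\begin{aligned}\min_{d,y}\quad&\nabla f(x^* )^\top d\\ \text{s.t.}\quad& c_i(x^* )+\nabla c_i(x^* )^\top d\ge0,&&i\in\mathcal A(x^* ),\\& x^*_{1,i}+d_{1,i}=0,\ x^*_{2,i}+d_{2,i}\ge0,&&i\in\mathcal I_{0+}(x^* ),\\& x^*_{1,i}+d_{1,i}\ge0,\ x^*_{2,i}+d_{2,i}=0,&&i\in\mathcal I_{+0}(x^* ),\\& 0\le x^*_{1,i}+d_{1,i}\le y_iM,&&i\in\mathcal I_{00}(x^* ),\\& 0\le x^*_{2,i}+d_{2,i}\le(1-y_i)M,&&i\in\mathcal I_{00}(x^* ),\\& \|d\|_\infty\le\rho.\end{aligned}$$ For $\rho<\frac M2$, $d=0$ is a global minimizer (i.e. the $d$-component of a global minimizer) of both this mixed-integer linear program and its relaxation in which $y_i\in\{0,1\}$ is replaced by $y_i\in[0,1]$.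
   Context: **MPEC.** Let $n=p+2m$, $x=(x_0,x_1,x_2)\in\mathbb R^p\times\mathbb R^m\times\mathbb R^m$, and let $f:\mathbb R^n\to\mathbb R$, $c:\mathbb R^n\to\mathbb R^{n_c}$ be twice continuously differentiable. The MPEC is $\min f(x)$ s.t. $x\in\Omega=\{x: c(x)\ge 0,\ 0\le x_1\perp x_2\ge 0\}$, where $0\le x_1\perp x_2\ge0$ means $x_{1,i},x_{2,i}\ge 0$, $x_{1,i}x_{2,i}=0$ for all $i$. **Index sets.** For $x\in\Omega$: $\mathcal I_{0+}(x)=\{i:x_{1,i}=0<x_{2,i}\}$, $\mathcal I_{+0}(x)=\{i:x_{1,i}>0=x_{2,i}\}$, $\mathcal I_{00}(x)=\{i:x_{1,i}=x_{2,i}=0\}$; $\mathcal A(x)=\{i:c_i(x)=0\}$. **S-stationarity.** $x^*\in\Omega$ is S-stationary if there are multipliers $\mu^*\in\mathbb R^{n_c}$, $\nu^*,\xi^*\in\mathbb R^m$ such that $\nabla_x\big(f(x)-\mu^{*\top}c(x)-\nu^{*\top}x_1-\xi^{*\top}x_2\big)\big|_{x=x^*}=0$, $0\le\mu^*\perp c(x^* )\ge0$, $\nu^*_i=0$ for $i\in\mathcal I_{+0}(x^* )$, $\xi^*_i=0$ for $i\in\mathcal I_{0+}(x^* )$, and $\nu^*_i\ge0,\ \xi^*_i\ge0$ for all $i\in\mathcal I_{00}(x^* )$. **MPEC-MFCQ** at $x^*\in\Omega$: the usual MFCQ holds at $x^*$ for the tight NLP $\min f(x)$ s.t. $c(x)\ge0$;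 $x_{1,i}=0,x_{2,i}\ge0$ ($i\in\mathcal I_{0+}(x^* )$); $x_{1,i}\ge0,x_{2,i}=0$ ($i\in\mathcal I_{+0}(x^* )$); $x_{1,i}=x_{2,i}=0$ ($i\in\mathcal I_{00}(x^* )$). *)

theory Defs
  imports "HOL-Analysis.Analysis"
begin

text \<open>
  The ambient space is \<open>real ^ 'n\<close> with \<open>CARD('n) = n = p + 2 * m\<close>. A bijection \<open>e\<close> from
  \<open>{..<p + 2 * m}\<close> to the index type numbers the coordinates and so fixes the block structure
  \<open>x = (x0, x1, x2)\<close>: block \<open>x0\<close> consists of the coordinates \<open>e 0, \<dots>, e (p - 1)\<close>, followed by the
  \<open>m\<close> coordinates of \<open>x1\<close> and the \<open>m\<close> coordinates of \<open>x2\<close>. This admits \<open>p = 0\<close>, which a product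
  \<open>real ^ 'p \<times> real ^ 'm \<times> real ^ 'm\<close> would not. The map \<open>c\<close> is given by its components
  \<open>c i\<close> with \<open>i < nc\<close>; indices are counted from 0, and values at indices out of range are
  never used.
\<close>

definition x1 :: "nat \<Rightarrow> (nat \<Rightarrow> 'n) \<Rightarrow> nat \<Rightarrow> real ^ 'n \<Rightarrow> real" where
  "x1 p e i x = x $ e (p + i)"

definition x2 :: "nat \<Rightarrow> nat \<Rightarrow> (nat \<Rightarrow> 'n) \<Rightarrow> nat \<Rightarrow> real ^ 'n \<Rightarrow> real" where
  "x2 p m e i x = x $ e (p + m + i)"

definition twice_continuously_differentiable :: "(real ^ 'n::finite \<Rightarrow> real) \<Rightarrow> bool" where
  "twice_continuously_differentiable f \<longleftrightarrow>
    (\<exists>(g :: real ^ 'n \<Rightarrow> real ^ 'n) (H :: real ^ 'n \<Rightarrow> real ^ 'n ^ 'n).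
      (\<forall>x. GDERIV f x :> g x) \<and>
      (\<forall>x. (g has_derivative (\<lambda>h. H x *v h)) (at x)) \<and>
      continuous_on UNIV H)"

text \<open>Meaningful only where the function is differentiable.\<close>

definition grad :: "(real ^ 'n::finite \<Rightarrow> real) \<Rightarrow> real ^ 'n \<Rightarrow> real ^ 'n" where
  "grad f x = (THE D. GDERIV f x :> D)"

lemma grad_eq:
  assumes "GDERIV f x :> D"
  shows "grad f x = D"
  unfolding grad_def
proof (rule the_equality)
  fix D' assume "GDERIV f x :> D'"
  with assms have "(\<lambda>h. h \<bullet> D') = (\<lambda>h. h \<bullet> D)"
    unfolding gderiv_def by (rule has_derivative_unique[rotated])
  then have "\<forall>h. h \<bullet> D' = h \<bullet> D" by meson
  then show "D' = D" by (metis inner_commute vector_eq_rdot)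
qed (rule assms)

definition Omega ::
  "nat \<Rightarrow> nat \<Rightarrow> nat \<Rightarrow> (nat \<Rightarrow> 'n) \<Rightarrow> (nat \<Rightarrow> real ^ 'n \<Rightarrow> real) \<Rightarrow> (real ^ 'n) set" where
  "Omega p m nc e c =
    {x. (\<forall>i<nc. c i x \<ge> 0) \<and>
        (\<forall>i<m. x1 p e i x \<ge> 0 \<and> x2 p m e i x \<ge> 0 \<and> x1 p e i x * x2 p m e i x = 0)}"

definition I0p :: "nat \<Rightarrow> nat \<Rightarrow> (nat \<Rightarrow> 'n) \<Rightarrow> real ^ 'n \<Rightarrow> nat set" where
  "I0p p m e x = {i. i < m \<and> x1 p e i x = 0 \<and> 0 < x2 p m e i x}"

definition Ip0 :: "nat \<Rightarrow> nat \<Rightarrow> (nat \<Rightarrow> 'n) \<Rightarrow> real ^ 'n \<Rightarrow> nat set" where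
  "Ip0 p m e x = {i. i < m \<and> x1 p e i x > 0 \<and> 0 = x2 p m e i x}"

definition I00 :: "nat \<Rightarrow> nat \<Rightarrow> (nat \<Rightarrow> 'n) \<Rightarrow> real ^ 'n \<Rightarrow> nat set" where
  "I00 p m e x = {i. i < m \<and> x1 p e i x = 0 \<and> x2 p m e i x = 0}"

definition active :: "nat \<Rightarrow> (nat \<Rightarrow> real ^ 'n \<Rightarrow> real) \<Rightarrow> real ^ 'n \<Rightarrow> nat set" where
  "active nc c x = {i. i < nc \<and> c i x = 0}"

definition S_stationary ::
  "nat \<Rightarrow> nat \<Rightarrow> nat \<Rightarrow> (nat \<Rightarrow> 'n::finite) \<Rightarrow> (real ^ 'n \<Rightarrow> real) \<Rightarrow> (nat \<Rightarrow> real ^ 'n \<Rightarrow> real)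
    \<Rightarrow> real ^ 'n \<Rightarrow> bool" where
  "S_stationary p m nc e f c xs \<longleftrightarrow>
    xs \<in> Omega p m nc e c \<and>
    (\<exists>\<mu> \<nu> \<xi> :: nat \<Rightarrow> real.
      grad (\<lambda>x. f x - (\<Sum>i<nc. \<mu> i * c i x) - (\<Sum>i<m. \<nu> i * x1 p e i x)
                    - (\<Sum>i<m. \<xi> i * x2 p m e i x)) xs = 0 \<and>
      (\<forall>i<nc. 0 \<le> \<mu> i \<and> c i xs \<ge> 0 \<and> \<mu> i * c i xs = 0) \<and>
      (\<forall>i\<in>Ip0 p m e xs. \<nu> i = 0) \<and>
      (\<forall>i\<in>I0p p m e xs. \<xi> i = 0) \<and>
      (\<forall>i\<in>I00 p m e xs. \<nu> i \<ge> 0 \<and> \<xi> i \<ge> 0))"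

text \<open>
  MFCQ at \<open>x\<close> for the constraints \<open>g i \<ge> 0\<close> (\<open>i \<in> I\<close>) and \<open>h j = 0\<close> (\<open>j \<in> J\<close>), \<open>J\<close> finite.
  Linear independence is that of the family of gradients indexed by \<open>J\<close>, not of the set of them.
\<close>

definition MFCQ ::
  "'i set \<Rightarrow> ('i \<Rightarrow> real ^ 'n::finite \<Rightarrow> real) \<Rightarrow> 'j set \<Rightarrow> ('j \<Rightarrow> real ^ 'n \<Rightarrow> real)
    \<Rightarrow> real ^ 'n \<Rightarrow> bool" where
  "MFCQ I g J h x \<longleftrightarrow>
    (\<forall>i\<in>I. g i x \<ge> 0) \<and> (\<forall>j\<in>J. h j x = 0) \<and>
    (\<forall>a. (\<Sum>j\<in>J. a j *\<^sub>R grad (h j) x) = 0 \<longrightarrow> (\<forall>j\<in>J. a j = 0)) \<and>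
    (\<exists>d. (\<forall>j\<in>J. grad (h j) x \<bullet> d = 0) \<and>
         (\<forall>i\<in>I. g i x = 0 \<longrightarrow> grad (g i) x \<bullet> d > 0))"

datatype constr = C nat | X1 nat | X2 nat

fun constr_fun ::
  "nat \<Rightarrow> nat \<Rightarrow> (nat \<Rightarrow> 'n) \<Rightarrow> (nat \<Rightarrow> real ^ 'n \<Rightarrow> real) \<Rightarrow> constr \<Rightarrow> real ^ 'n \<Rightarrow> real" where
  "constr_fun p m e c (C i) = c i"
| "constr_fun p m e c (X1 i) = x1 p e i"
| "constr_fun p m e c (X2 i) = x2 p m e i"

text \<open>MFCQ for the tight NLP, whose index sets are frozen at \<open>xs\<close>.\<close>

definition MPEC_MFCQ ::
  "nat \<Rightarrow> nat \<Rightarrow> nat \<Rightarrow> (nat \<Rightarrow> 'n::finite) \<Rightarrow> (nat \<Rightarrow> real ^ 'n \<Rightarrow> real) \<Rightarrow> real ^ 'n \<Rightarrow> bool" where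
  "MPEC_MFCQ p m nc e c xs \<longleftrightarrow>
    MFCQ (C ` {..<nc} \<union> X2 ` I0p p m e xs \<union> X1 ` Ip0 p m e xs) (constr_fun p m e c)
         (X1 ` (I0p p m e xs \<union> I00 p m e xs) \<union> X2 ` (Ip0 p m e xs \<union> I00 p m e xs))
         (constr_fun p m e c) xs"

text \<open>
  Feasible pairs \<open>(d, y)\<close> of the mixed-integer program (\<open>Y = {0, 1}\<close>) and of its relaxation
  (\<open>Y = {0..1}\<close>). The extensional function space makes \<open>y\<close> a vector indexed by \<open>I00\<close> only.
\<close>

definition LPEC_feasible ::
  "nat \<Rightarrow> nat \<Rightarrow> nat \<Rightarrow> (nat \<Rightarrow> 'n::finite) \<Rightarrow> (nat \<Rightarrow> real ^ 'n \<Rightarrow> real) \<Rightarrow> real ^ 'n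
    \<Rightarrow> real \<Rightarrow> real \<Rightarrow> real set \<Rightarrow> ((real ^ 'n) \<times> (nat \<Rightarrow> real)) set" where
  "LPEC_feasible p m nc e c xs M \<rho> Y =
    {(d, y). y \<in> I00 p m e xs \<rightarrow>\<^sub>E Y \<and>
      (\<forall>i\<in>active nc c xs. c i xs + grad (c i) xs \<bullet> d \<ge> 0) \<and>
      (\<forall>i\<in>I0p p m e xs. x1 p e i xs + x1 p e i d = 0 \<and> x2 p m e i xs + x2 p m e i d \<ge> 0) \<and>
      (\<forall>i\<in>Ip0 p m e xs. x1 p e i xs + x1 p e i d \<ge> 0 \<and> x2 p m e i xs + x2 p m e i d = 0) \<and>
      (\<forall>i\<in>I00 p m e xs. 0 \<le> x1 p e i xs + x1 p e i d \<and> x1 p e i xs + x1 p e i d \<le> y i * M) \<and>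
      (\<forall>i\<in>I00 p m e xs. 0 \<le> x2 p m e i xs + x2 p m e i d \<and>
                         x2 p m e i xs + x2 p m e i d \<le> (1 - y i) * M) \<and>
      infnorm d \<le> \<rho>}"

definition LPEC_minimizer ::
  "nat \<Rightarrow> nat \<Rightarrow> nat \<Rightarrow> (nat \<Rightarrow> 'n::finite) \<Rightarrow> (real ^ 'n \<Rightarrow> real) \<Rightarrow> (nat \<Rightarrow> real ^ 'n \<Rightarrow> real)
    \<Rightarrow> real ^ 'n \<Rightarrow> real \<Rightarrow> real \<Rightarrow> real set \<Rightarrow> (real ^ 'n) \<times> (nat \<Rightarrow> real) \<Rightarrow> bool" where
  "LPEC_minimizer p m nc e f c xs M \<rho> Y =
    is_arg_min (\<lambda>(d, y). grad f xs \<bullet> d) (\<lambda>z. z \<in> LPEC_feasible p m nc e c xs M \<rho> Y)"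

end

theory Submission
  imports Defs
begin

text \<open>
  S-stationarity writes \<open>\<nabla>f(x*)\<close> as a combination, with the multipliers \<open>\<mu>\<close>, \<open>\<nu>\<close>, \<open>\<xi>\<close>, of the
  gradients of the constraints. Pairing this identity with a direction \<open>d\<close> splits
  \<open>\<nabla>f(x*) \<bullet> d\<close> into products of a multiplier and a linearised constraint, and for every
  feasible \<open>d\<close> each product is nonnegative: either the multiplier vanishes by complementarity,
  or \<open>d\<close> vanishes in that component, or both factors are nonnegative. The last case is what
  happens on the biactive set \<open>I00\<close>: S-stationarity makes both multipliers nonnegative there,
  and both components of \<open>d\<close> are nonnegative whatever the value of \<open>y\<close>. So no
  feasible direction has a negative objective (lemma \<open>S_stationary_imp_nonneg_objective\<close>).

  Since \<open>d = 0\<close> is feasible and has objective 0 (lemma \<open>zero_in_LPEC_feasible\<close>), it is optimal.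
  The lower bound holds for every range \<open>Y\<close> of \<open>y\<close>, so the mixed-integer program and its
  relaxation are settled by the same argument.
\<close>

lemma GDERIV_grad:
  assumes "twice_continuously_differentiable f"
  shows "GDERIV f x :> grad f x"
  using assms grad_eq unfolding twice_continuously_differentiable_def by metis

lemma GDERIV_coordinate: "GDERIV (\<lambda>x. x $ k) (x :: real ^ 'n::finite) :> axis k 1"
proof -
  have "((\<lambda>x :: real ^ 'n. x $ k) has_derivative (\<lambda>h. h $ k)) (at x)"
    by (rule bounded_linear_imp_has_derivative[OF bounded_linear_vec_nth])
  then show ?thesis
    by (simp add: gderiv_def inner_axis)
qed

lemma GDERIV_weighted_sum:
  assumes "\<And>i. i < n \<Longrightarrow> GDERIV (g i) x :> G i"
  shows "GDERIV (\<lambda>x. \<Sum>i<n. a i * g i x) x :> (\<Sum>i<n. a i *\<^sub>R G i)"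
  using assms unfolding gderiv_def inner_sum_right inner_scaleR_right
  by (auto intro!: has_derivative_sum has_derivative_mult_right)

text \<open>
  Stationarity is given as a zero of the gradient of the whole Lagrangian; this expansion is what
  separates the contributions of the individual constraints along a direction.
\<close>

lemma inner_grad_Lagrangian:
  fixes f :: "real ^ 'n::finite \<Rightarrow> real"
  assumes f: "twice_continuously_differentiable f"
    and c: "\<And>i. i < nc \<Longrightarrow> twice_continuously_differentiable (c i)"
  shows "grad (\<lambda>x. f x - (\<Sum>i<nc. \<mu> i * c i x) - (\<Sum>i<m. \<nu> i * x1 p e i x)
                       - (\<Sum>i<m. \<xi> i * x2 p m e i x)) x \<bullet> d
    = grad f x \<bullet> d - (\<Sum>i<nc. \<mu> i * (grad (c i) x \<bullet> d)) - (\<Sum>i<m. \<nu> i * x1 p e i d)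
      - (\<Sum>i<m. \<xi> i * x2 p m e i d)"
proof -
  have "GDERIV (\<lambda>x. f x - (\<Sum>i<nc. \<mu> i * c i x) - (\<Sum>i<m. \<nu> i * x1 p e i x)
                        - (\<Sum>i<m. \<xi> i * x2 p m e i x)) x
    :> grad f x - (\<Sum>i<nc. \<mu> i *\<^sub>R grad (c i) x) - (\<Sum>i<m. \<nu> i *\<^sub>R axis (e (p + i)) 1)
       - (\<Sum>i<m. \<xi> i *\<^sub>R axis (e (p + m + i)) 1)"
    unfolding x1_def x2_def
    by (intro GDERIV_diff GDERIV_weighted_sum GDERIV_grad GDERIV_coordinate f c)
  from grad_eq[OF this] show ?thesis
    by (simp add: inner_diff_left inner_sum_left inner_axis' x1_def x2_def)
qed

text \<open>
  The nonnegativity comes from the cone of directions of the problem in which every biactive pair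
  satisfies just \<open>x1 \<ge> 0\<close> and \<open>x2 \<ge> 0\<close>: for that problem S-stationarity is the KKT condition, and
  each choice of \<open>y\<close> selects a subset of its linearised directions.
\<close>

lemma S_stationary_imp_nonneg_objective:
  assumes f: "twice_continuously_differentiable f"
    and c: "\<And>i. i < nc \<Longrightarrow> twice_continuously_differentiable (c i)"
    and S: "S_stationary p m nc e f c xs"
    and d: "(d, y) \<in> LPEC_feasible p m nc e c xs M \<rho> Y"
  shows "grad f xs \<bullet> d \<ge> 0"
proof -
  from S obtain \<mu> \<nu> \<xi> where Om: "xs \<in> Omega p m nc e c"
    and L: "grad (\<lambda>x. f x - (\<Sum>i<nc. \<mu> i * c i x) - (\<Sum>i<m. \<nu> i * x1 p e i x)
                       - (\<Sum>i<m. \<xi> i * x2 p m e i x)) xs = 0"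
    and \<mu>: "\<forall>i<nc. 0 \<le> \<mu> i \<and> c i xs \<ge> 0 \<and> \<mu> i * c i xs = 0"
    and \<nu>: "\<forall>i\<in>Ip0 p m e xs. \<nu> i = 0" and \<xi>: "\<forall>i\<in>I0p p m e xs. \<xi> i = 0"
    and \<nu>\<xi>: "\<forall>i\<in>I00 p m e xs. \<nu> i \<ge> 0 \<and> \<xi> i \<ge> 0"
    unfolding S_stationary_def by auto
  have dc: "\<forall>i\<in>active nc c xs. c i xs + grad (c i) xs \<bullet> d \<ge> 0"
    and d0p: "\<forall>i\<in>I0p p m e xs. x1 p e i xs + x1 p e i d = 0"
    and dp0: "\<forall>i\<in>Ip0 p m e xs. x2 p m e i xs + x2 p m e i d = 0"
    and d00: "\<forall>i\<in>I00 p m e xs. 0 \<le> x1 p e i xs + x1 p e i d \<and> 0 \<le> x2 p m e i xs + x2 p m e i d"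
    using d unfolding LPEC_feasible_def by auto
  have "0 \<le> \<mu> i * (grad (c i) xs \<bullet> d)" if "i < nc" for i
    using that \<mu> dc by (cases "c i xs = 0") (auto simp: active_def)
  moreover have "0 \<le> \<nu> i * x1 p e i d \<and> 0 \<le> \<xi> i * x2 p m e i d" if "i < m" for i
  proof -
    have "x1 p e i xs \<ge> 0" "x2 p m e i xs \<ge> 0" "x1 p e i xs * x2 p m e i xs = 0"
      using Om that by (auto simp: Omega_def)
    then consider "i \<in> I0p p m e xs" | "i \<in> Ip0 p m e xs" | "i \<in> I00 p m e xs"
      using \<open>i < m\<close> by (auto simp: I0p_def Ip0_def I00_def le_less)
    then show ?thesis
    proof cases
      case 1
      then have "x1 p e i d = 0" using d0p by (auto simp: I0p_def)
      with 1 \<xi> show ?thesis by simp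
    next
      case 2
      then have "x2 p m e i d = 0" using dp0 by (auto simp: Ip0_def)
      with 2 \<nu> show ?thesis by simp
    next
      case 3
      then have "0 \<le> x1 p e i d" "0 \<le> x2 p m e i d" using d00 by (auto simp: I00_def)
      with 3 \<nu>\<xi> show ?thesis by simp
    qed
  qed
  ultimately have "0 \<le> (\<Sum>i<nc. \<mu> i * (grad (c i) xs \<bullet> d))"
    "0 \<le> (\<Sum>i<m. \<nu> i * x1 p e i d)" "0 \<le> (\<Sum>i<m. \<xi> i * x2 p m e i d)"
    by (auto intro!: sum_nonneg)
  moreover have "grad f xs \<bullet> d = (\<Sum>i<nc. \<mu> i * (grad (c i) xs \<bullet> d))
      + (\<Sum>i<m. \<nu> i * x1 p e i d) + (\<Sum>i<m. \<xi> i * x2 p m e i d)"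
    using inner_grad_Lagrangian
      [where c = c and nc = nc and \<mu> = \<mu> and \<nu> = \<nu> and \<xi> = \<xi> and m = m and p = p
         and e = e and x = xs and d = d, OF f c] unfolding L by simp
  ultimately show ?thesis by simp
qed

text \<open>
  At \<open>d = 0\<close> the biactive components are 0, so both bounds \<open>y i * M\<close> and \<open>(1 - y i) * M\<close> hold for
  any \<open>y i\<close> in the unit interval; the choice 0 lies in both ranges \<open>{0, 1}\<close> and \<open>{0..1}\<close>.
\<close>

lemma zero_in_LPEC_feasible:
  assumes "xs \<in> Omega p m nc e c" and "0 \<in> Y" and "M \<ge> 0" and "\<rho> \<ge> 0"
  shows "(0, \<lambda>i\<in>I00 p m e xs. 0) \<in> LPEC_feasible p m nc e c xs M \<rho> Y"
  using assms
  by (auto simp: LPEC_feasible_def active_def I0p_def Ip0_def I00_def x1_def x2_def infnorm_0)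

lemma LPEC_minimizer_zero:
  assumes "twice_continuously_differentiable f"
    and "\<And>i. i < nc \<Longrightarrow> twice_continuously_differentiable (c i)"
    and S: "S_stationary p m nc e f c xs"
    and Y: "0 \<in> Y" and "M \<ge> 0" and "\<rho> \<ge> 0"
  shows "LPEC_minimizer p m nc e f c xs M \<rho> Y (0, \<lambda>i\<in>I00 p m e xs. 0)"
proof -
  have "xs \<in> Omega p m nc e c"
    using S by (simp add: S_stationary_def)
  note feasible = zero_in_LPEC_feasible[OF this Y assms(5,6)]
  have "0 \<le> grad f xs \<bullet> d" if "(d, y) \<in> LPEC_feasible p m nc e c xs M \<rho> Y" for d y
    using S_stationary_imp_nonneg_objective assms(1,2) S that by blast
  with feasible show ?thesis
    by (force simp: LPEC_minimizer_def is_arg_min_def not_less)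
qed

theorem proposition3p1:
  fixes p m nc :: nat
    and e :: "nat \<Rightarrow> 'n::finite"
    and f :: "real ^ 'n \<Rightarrow> real"
    and c :: "nat \<Rightarrow> real ^ 'n \<Rightarrow> real"
    and xs :: "real ^ 'n"
    and M \<rho> :: real
  assumes "bij_betw e {..<p + 2 * m} UNIV"
    and "twice_continuously_differentiable f"
    and "\<And>i. i < nc \<Longrightarrow> twice_continuously_differentiable (c i)"
    and "xs \<in> Omega p m nc e c"
    and "S_stationary p m nc e f c xs"
    and "MPEC_MFCQ p m nc e c xs"
    and "M > 0" and "\<rho> > 0"
    and "\<rho> < M / 2"
  shows "(\<exists>y. LPEC_minimizer p m nc e f c xs M \<rho> {0, 1} (0, y)) \<and>
         (\<exists>y. LPEC_minimizer p m nc e f c xs M \<rho> {0..1} (0, y))"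
  using LPEC_minimizer_zero[of f nc c p m e xs "{0, 1}" M \<rho>]
    LPEC_minimizer_zero[of f nc c p m e xs "{0..1}" M \<rho>] assms
  by (metis atLeastAtMost_iff insertI1 less_imp_le order_refl zero_le_one)

end
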